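(* Let $q\ge 1$ and $L\ge 0$ be integers. The maximal probability $c_{q,L}:=\max_{k}P\left(U_q^{\star L}=k\right)$ of the $L$-th convolution power of the discrete uniform distribution on $\{0,1,\ldots,q\}$ is $$c_{q,L}=\frac{1}{(q+1)^L}\binom{L}{\lfloor (qL+1)/2\rfloor}_q .$$
   Context: For integers $q\ge 1$, $L\ge 0$, the ordinary multinomial $\binom{L}{k}_q$ is the coefficient of $x^k$ in $(1+x+x^2+\cdots+x^q)^L$. $U_q=\frac{1}{q+1}(\delta_0+\delta_1+\cdots+\delta_q)$ denotes the discrete uniform distribution on $\{0,1,\ldots,q\}$ ($\delta_a$ is the Dirac measure at $a$), and $U_q^{\star L}$ is its $L$-th convolution power, i.e. the distribution of the sum of $L$ independent random variables uniform on $\{0,\ldots,q\}$ (with $U_q^{\star 0}=\delta_0$). $P(U_q^{\star L}=k)$ is the mass that this distribution gives to the integer $k$. *)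

theory Defs
  imports "HOL-Probability.Probability" "HOL-Computational_Algebra.Polynomial"
begin

definition multinomial :: "nat \<Rightarrow> nat \<Rightarrow> nat \<Rightarrow> nat" where
  "multinomial q L k = coeff ((\<Sum>i\<le>q. monom 1 i) ^ L) k"

definition unif :: "nat \<Rightarrow> int pmf" where
  "unif q = pmf_of_set {0..int q}"

text \<open>The distribution of the sum of two independent random variables with laws \<open>\<mu>\<close> and \<open>\<nu>\<close>.
  The library's \<^const>\<open>convolution\<close> is for measures on a Euclidean space only.\<close>

definition conv_pmf :: "'a::monoid_add pmf \<Rightarrow> 'a pmf \<Rightarrow> 'a pmf" where
  "conv_pmf \<mu> \<nu> = map_pmf (\<lambda>(x, y). x + y) (pair_pmf \<mu> \<nu>)"

primrec conv_power :: "'a::monoid_add pmf \<Rightarrow> nat \<Rightarrow> 'a pmf" where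
  "conv_power \<mu> 0 = return_pmf 0"
| "conv_power \<mu> (Suc L) = conv_pmf \<mu> (conv_power \<mu> L)"

definition max_prob :: "nat \<Rightarrow> nat \<Rightarrow> real" where
  "max_prob q L = Max (range (\<lambda>k::int. pmf (conv_power (unif q) L) k))"

text \<open>\<^const>\<open>Max\<close> is meaningful only on finite nonempty sets; the set in \<^const>\<open>max_prob\<close>
  is one, because the support is finite.\<close>

lemma finite_range_pmf:
  assumes "finite (set_pmf p)"
  shows "finite (range (pmf p))"
proof (rule finite_subset)
  show "range (pmf p) \<subseteq> insert 0 (pmf p ` set_pmf p)"
    by (auto simp: set_pmf_iff)
  show "finite (insert 0 (pmf p ` set_pmf p))"
    using assms by simp
qed

lemma finite_set_pmf_conv_power_unif: "finite (set_pmf (conv_power (unif q) L))"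
  by (induction L) (auto simp: conv_pmf_def unif_def set_pmf_of_set)

lemma finite_range_conv_power_unif:
  "finite (range (\<lambda>k::int. pmf (conv_power (unif q) L) k))"
  using finite_range_pmf[OF finite_set_pmf_conv_power_unif] by simp

end

theory Submission
  imports Defs
begin

text \<open>Convolving a symmetric unimodal law with the uniform law keeps it symmetric and unimodal: the
  difference of two neighbouring masses of the new law is, up to the factor \<open>1 / (q + 1)\<close>, the
  difference of two masses of the old law whose points are \<open>q + 1\<close> apart, and symmetric unimodality
  compares these by their distance to the centre. So the maximal mass sits at an integer closest to
  the centre \<open>q L / 2\<close>, and the convolution recursion is that of the multinomial coefficients.\<close>

lemma pmf_conv_unif:
  "pmf (conv_pmf (unif q) \<nu>) k = (\<Sum>i\<in>{0..int q}. pmf \<nu> (k - i)) / (real q + 1)"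
proof -
  have "conv_pmf (unif q) \<nu> = bind_pmf (unif q) (\<lambda>x. map_pmf ((+) x) \<nu>)"
    by (simp add: conv_pmf_def pair_pmf_def map_pmf_def bind_assoc_pmf bind_return_pmf)
  moreover have "pmf (map_pmf ((+) x) \<nu>) k = pmf \<nu> (k - x)" for x :: int
    using pmf_map_inj'[of "(+) x" \<nu> "k - x"] by (simp add: inj_def)
  ultimately show ?thesis
    by (simp add: pmf_bind unif_def integral_pmf_of_set)
qed

lemma pmf_conv_power_unif_Suc:
  "pmf (conv_power (unif q) (Suc L)) k =
    (\<Sum>i\<in>{0..int q}. pmf (conv_power (unif q) L) (k - i)) / (real q + 1)"
  by (simp add: pmf_conv_unif)

text \<open>The substitution \<open>i\<close> to \<open>q - i\<close> preserves the uniform summand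
  and turns reflection about \<open>q * Suc L / 2\<close> into reflection about
  \<open>q * L / 2\<close>.\<close>

lemma pmf_conv_power_unif_symmetric:
  "pmf (conv_power (unif q) L) (int (q * L) - k) = pmf (conv_power (unif q) L) k"
proof (induction L arbitrary: k)
  case 0
  then show ?case by (simp add: indicator_def)
next
  case (Suc L)
  have "(\<Sum>i\<in>{0..int q}. pmf (conv_power (unif q) L) (int (q * Suc L) - k - i)) =
        (\<Sum>i\<in>{0..int q}. pmf (conv_power (unif q) L) (k - i))"
  proof (rule sum.reindex_bij_witness[where i = "\<lambda>i. int q - i" and j = "\<lambda>i. int q - i"])
    fix i
    have "int (q * L) - (k - (int q - i)) = int (q * Suc L) - k - i"
      by (simp add: algebra_simps)
    then show "pmf (conv_power (unif q) L) (k - (int q - i)) =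
        pmf (conv_power (unif q) L) (int (q * Suc L) - k - i)"
      using Suc.IH[of "k - (int q - i)"] by metis
  qed auto
  then show ?case
    by (simp only: pmf_conv_power_unif_Suc)
qed

lemma symmetric_unimodal_le:
  fixes f :: "int \<Rightarrow> 'a::preorder"
  assumes symm: "\<And>k. f (c - k) = f k"
    and step: "\<And>k. 2 * k < c \<Longrightarrow> f k \<le> f (k + 1)"
    and closer: "\<bar>2 * j - c\<bar> \<le> \<bar>2 * k - c\<bar>"
  shows "f k \<le> f j"
proof -
  \<comment> \<open>The bound on \<open>b\<close> is exactly what the last step, from
    \<open>b - 1\<close> to \<open>b\<close>, requires: \<open>2 * (b - 1) < c\<close>.\<close>
  have chain: "f a \<le> f b" if "a \<le> b" "2 * b \<le> c + 1" for a b
    using that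
  proof (induction b rule: int_ge_induct)
    case (step b)
    then show ?case using assms(2)[of b] by (force intro: order_trans)
  qed simp
  \<comment> \<open>Both points are folded into the left half, where being closer to the centre
    means being larger.\<close>
  define k' j' where "k' = min k (c - k)" and "j' = min j (c - j)"
  have "f k' \<le> f j'"
    using closer by (intro chain) (auto simp: k'_def j'_def min_def)
  moreover have "f k' = f k" "f j' = f j"
    by (auto simp: k'_def j'_def min_def symm)
  ultimately show ?thesis by simp
qed

text \<open>Comparing by distance, not just between neighbours, lets the induction hypothesis relate
  points that are \<open>q + 1\<close> apart.\<close>

lemma pmf_conv_power_unif_le:
  assumes "\<bar>2 * j - int (q * L)\<bar> \<le> \<bar>2 * k - int (q * L)\<bar>"
  shows "pmf (conv_power (unif q) L) k \<le> pmf (conv_power (unif q) L) j"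
  using assms
proof (induction L arbitrary: j k)
  case 0
  then show ?case by (auto simp: indicator_def)
next
  case (Suc L)
  let ?p = "pmf (conv_power (unif q) L)"
  show ?case
  proof (rule symmetric_unimodal_le[where c = "int (q * Suc L)"])
    fix k :: int
    assume k: "2 * k < int (q * Suc L)"
    \<comment> \<open>The windows ending at \<open>k\<close> and \<open>k + 1\<close> share all but
      one term each.\<close>
    have "(\<Sum>i\<in>{0..int q}. ?p (k + 1 - i)) = ?p (k + 1) + (\<Sum>i\<in>{1..int q}. ?p (k + 1 - i))"
    proof -
      have "{0..int q} = insert 0 {1..int q}" by auto
      then show ?thesis by simp
    qed
    moreover have "(\<Sum>i\<in>{0..int q}. ?p (k - i)) = ?p (k - int q) + (\<Sum>i\<in>{0..<int q}. ?p (k - i))"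
    proof -
      have "{0..int q} = insert (int q) {0..<int q}" by auto
      then show ?thesis by simp
    qed
    moreover have "(\<Sum>i\<in>{0..<int q}. ?p (k - i)) = (\<Sum>i\<in>{1..int q}. ?p (k + 1 - i))"
      by (rule sum.reindex_bij_witness[where i = "\<lambda>i. i - 1" and j = "\<lambda>i. i + 1"]) auto
    \<comment> \<open>As \<open>2 * k + 1 \<le> q * Suc L\<close>, the midpoint of
      \<open>k - q\<close> and \<open>k + 1\<close> is at most \<open>q * L / 2\<close>, so
      \<open>k + 1\<close> is no farther from that centre.\<close>
    moreover have "?p (k - int q) \<le> ?p (k + 1)"
      using k by (intro Suc.IH) (simp add: algebra_simps)
    ultimately show "pmf (conv_power (unif q) (Suc L)) k \<le> pmf (conv_power (unif q) (Suc L)) (k + 1)"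
      unfolding pmf_conv_power_unif_Suc by (intro divide_right_mono) auto
  qed (fact pmf_conv_power_unif_symmetric Suc.prems)+
qed

lemma pmf_conv_power_unif_neg: "k < 0 \<Longrightarrow> pmf (conv_power (unif q) L) k = 0"
proof (induction L arbitrary: k)
  case 0
  then show ?case by (simp add: indicator_def)
next
  case (Suc L)
  then show ?case
    unfolding pmf_conv_power_unif_Suc by simp
qed

lemma multinomial_0: "multinomial q 0 k = (if k = 0 then 1 else 0)"
  by (simp add: multinomial_def)

lemma multinomial_Suc:
  "multinomial q (Suc L) k = (\<Sum>i\<le>q. if i \<le> k then multinomial q L (k - i) else 0)"
  by (auto simp: multinomial_def sum_distrib_right coeff_sum coeff_monom_mult intro!: sum.cong)

lemma pmf_conv_power_unif:
  "pmf (conv_power (unif q) L) (int k) = real (multinomial q L k) / (real q + 1) ^ L"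
proof (induction L arbitrary: k)
  case 0
  then show ?case by (simp add: pmf_return multinomial_0)
next
  case (Suc L)
  let ?p = "pmf (conv_power (unif q) L)"
  have "(\<Sum>i\<in>{0..int q}. ?p (int k - i)) = (\<Sum>i\<le>q. ?p (int k - int i))"
    by (rule sum.reindex_bij_witness[where i = int and j = nat]) auto
  also have "\<dots> = (\<Sum>i\<le>q. real (if i \<le> k then multinomial q L (k - i) else 0) / (real q + 1) ^ L)"
  proof (rule sum.cong)
    fix i
    show "?p (int k - int i) =
        real (if i \<le> k then multinomial q L (k - i) else 0) / (real q + 1) ^ L"
      \<comment> \<open>For \<open>i > k\<close> the difference \<open>k - i\<close> truncates in
        \<open>nat\<close>; there the mass at a negative integer gives the 0 branch instead.\<close>
      using Suc.IH[of "k - i"] by (auto simp: pmf_conv_power_unif_neg of_nat_diff)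
  qed simp
  also have "\<dots> = real (multinomial q (Suc L) k) / (real q + 1) ^ L"
    by (simp add: multinomial_Suc sum_divide_distrib)
  finally show ?case
    unfolding pmf_conv_power_unif_Suc by simp
qed

theorem theorem5:
  fixes q L :: nat
  assumes "q \<ge> 1"
  shows "max_prob q L = 1 / (real q + 1) ^ L * real (multinomial q L ((q * L + 1) div 2))"
proof -
  let ?m = "(q * L + 1) div 2"
  have "max_prob q L = pmf (conv_power (unif q) L) (int ?m)"
    unfolding max_prob_def
  proof (rule Max_eqI[OF finite_range_conv_power_unif])
    fix y
    assume "y \<in> range (pmf (conv_power (unif q) L))"
    then obtain k where y: "y = pmf (conv_power (unif q) L) k" by blast
    \<comment> \<open>The left side is 0 or 1 according to the parity of \<open>N\<close>, and
      \<open>2 * k - N\<close> has that same parity.\<close>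
    have "\<bar>2 * int n - int N\<bar> \<le> \<bar>2 * k - int N\<bar>" if "n = (N + 1) div 2" for n N
      using that by presburger
    then show "y \<le> pmf (conv_power (unif q) L) (int ?m)"
      unfolding y by (intro pmf_conv_power_unif_le) blast
  qed simp
  then show ?thesis by (simp add: pmf_conv_power_unif)
qed

end
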